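(* Let $X$ be a finite-state reversible ergodic continuous-time Markov process with state space $\mathcal X$ and invariant probability $\pi$ as in the context. Let $p\in(0,1]$ and $p'\in(0,1]$. There exists a universal function $C_{p,p'}$ of $(p,p')$ such that, for any probability measure $\eta$ on $\mathcal X$ and any $t>0$, $$d_\eta(t)\le C_{p,p'}\,\mathcal L_\eta(p')^{-p'/2}\,\mathcal L(p)^{-pp'/(4-2p)}\,t^{-p'/(2-p)} .$$ One may take $C_{p,p'}=e^{-p'/2}\left(\frac{p}{2-p}\right)^{pp'/(4-2p)}$. As a consequence, for any $\varepsilon>0$, $$T_\eta(\varepsilon)\le \tilde C_{p}\,\mathcal L_\eta(p')^{-(2-p)/2}\,\mathcal L(p)^{-p/2}\,\varepsilon^{-(2-p)/p'},\qquad \text{where } \tilde C_{p}=e^{-(2-p)/2}\left(\frac{p}{2-p}\right)^{p/2}.$$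
   Context: $X=(X_t)_{t\ge0}$ is a homogeneous continuous-time Markov process on a finite set $\mathcal X$, with transition matrix (jump rates) $K(x,y)$. It has a unique invariant, ergodic probability measure $\pi$; $\pi(x)>0$ for all $x\in\mathcal X$ and $\pi$ is reversible, i.e. the kernel $k(x,y)=K(x,y)/\pi(y)$ is symmetric. The semigroup is $P_tf(x)=E_x[f(X_t)]$. The Dirichlet form is $$\mathcal E(f,g)=\tfrac12\sum_{x,y}(f(x)-f(y))(g(x)-g(y))\,k(x,y)\pi(x)\pi(y).$$ For a probability measure $\eta$ on $\mathcal X$ and a function $f:\mathcal X\to\mathbb R$, $\eta(f)=\sum_x\eta(x)f(x)$ and $\|f\|_\infty=\max_x|f(x)|$. For $p\in(0,1]$, $$\mathcal L_\eta(p)=\inf_{f:\ \pi(f)=0}\frac{\mathcal E(f,f)\,\|f\|_\infty^{(2-2p)/p}}{\eta(|f|)^{2/p}},\qquad \mathcal L(p)=\mathcal L_\pi(p),$$ the infimum being over functions $f$ for which the quotient makes sense, i.e. $\eta(|f|)>0$. Further, $$d_\eta(t)=\sup_{s\ge t}\ \sup_{\|f\|_\infty\le1}\eta\big(|P_sf-\pi(f)|\big),\qquad T_\eta(\varepsilon)=\inf\{t>0:\ d_\eta(t)\le\varepsilon\}.$$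
   Formalization: The printed constants fail (two states, π=(0.9,0.1), η=δ_b, p=1, p'=t=0.1). For d_η, T_η they are multiplied by 2^{1-p'/(2-p)} and 2^{(2-p)/p'-1}, so the T_η constant depends on p' too; the printed constants are proved when the sup is over f with π(f)=0. *)

theory Defs
  imports "HOL-Probability.Probability"
begin

text \<open>
  The finite state space is a type of class \<open>finite\<close>.  A homogeneous Markov process is given
  by its family of laws \<open>M x\<close> (the process started at \<open>x\<close>) on a common measurable space and by
  the coordinate maps \<open>X t\<close>.
\<close>

definition event :: "'w measure \<Rightarrow> (real \<Rightarrow> 'w \<Rightarrow> 'x) \<Rightarrow> real \<Rightarrow> 'x \<Rightarrow> 'w set" where
  "event N X t y = {\<omega> \<in> space N. X t \<omega> = y}"

text \<open>The \<open>\<sigma>\<close>-algebra generated by \<open>X u\<close> for \<open>0 \<le> u \<le> s\<close>.\<close>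

definition past :: "'w measure \<Rightarrow> (real \<Rightarrow> 'w \<Rightarrow> 'x) \<Rightarrow> real \<Rightarrow> 'w set set" where
  "past N X s = sigma_sets (space N) {event N X u y |u y. 0 \<le> u \<and> u \<le> s}"

definition semigroup_op ::
  "('x \<Rightarrow> 'w measure) \<Rightarrow> (real \<Rightarrow> 'w \<Rightarrow> 'x) \<Rightarrow> real \<Rightarrow> ('x \<Rightarrow> real) \<Rightarrow> 'x \<Rightarrow> real" where
  "semigroup_op M X t f x = (\<integral>\<omega>. f (X t \<omega>) \<partial>M x)"

definition mean :: "'x::finite pmf \<Rightarrow> ('x \<Rightarrow> real) \<Rightarrow> real" where
  "mean \<eta> f = (\<Sum>x\<in>UNIV. pmf \<eta> x * f x)"

definition sup_norm :: "('x::finite \<Rightarrow> real) \<Rightarrow> real" where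
  "sup_norm f = Max (range (\<lambda>x. \<bar>f x\<bar>))"

text \<open>
  The diagonal entries of the matrix \<open>K\<close> of jump rates are left arbitrary: neither the process nor
  the Dirichlet form involves them.  The probability of a jump \<open>x \<rightarrow> y\<close> before time \<open>t\<close> being
  \<open>K x y * t + o(t)\<close> is expressed by a right derivative at \<open>0\<close>.
\<close>

locale markov_process =
  fixes M :: "'x::finite \<Rightarrow> 'w measure" and X :: "real \<Rightarrow> 'w \<Rightarrow> 'x" and K :: "'x \<Rightarrow> 'x \<Rightarrow> real"
  assumes prob_space_law: "\<And>x. prob_space (M x)"
    and sets_law: "\<And>x y. sets (M x) = sets (M y)"
    and measurable_process: "\<And>x t. 0 \<le> t \<Longrightarrow> X t \<in> M x \<rightarrow>\<^sub>M count_space UNIV"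
    and start: "\<And>x. AE \<omega> in M x. X 0 \<omega> = x"
    and markov: "\<And>x s t A y z. 0 \<le> s \<Longrightarrow> 0 \<le> t \<Longrightarrow> A \<in> past (M x) X s \<Longrightarrow>
      measure (M x) (A \<inter> event (M x) X s y \<inter> event (M x) X (s + t) z) =
      measure (M x) (A \<inter> event (M x) X s y) * measure (M y) (event (M y) X t z)"
    and jump_rate: "\<And>x y. x \<noteq> y \<Longrightarrow>
      ((\<lambda>t. measure (M x) (event (M x) X t y)) has_real_derivative K x y) (at 0 within {0..})"

definition invariant_law ::
  "('x::finite \<Rightarrow> 'w measure) \<Rightarrow> (real \<Rightarrow> 'w \<Rightarrow> 'x) \<Rightarrow> 'x pmf \<Rightarrow> bool" where
  "invariant_law M X \<mu> \<longleftrightarrow> (\<forall>t\<ge>0. \<forall>f. mean \<mu> (semigroup_op M X t f) = mean \<mu> f)"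

definition ergodic_law ::
  "('x::finite \<Rightarrow> 'w measure) \<Rightarrow> (real \<Rightarrow> 'w \<Rightarrow> 'x) \<Rightarrow> 'x pmf \<Rightarrow> bool" where
  "ergodic_law M X \<mu> \<longleftrightarrow>
    (\<forall>A. (\<forall>t\<ge>0. AE x in measure_pmf \<mu>. semigroup_op M X t (indicator A) x = indicator A x) \<longrightarrow>
         measure_pmf.prob \<mu> A = 0 \<or> measure_pmf.prob \<mu> A = 1)"

definition sym_kernel :: "('x \<Rightarrow> 'x \<Rightarrow> real) \<Rightarrow> 'x pmf \<Rightarrow> 'x \<Rightarrow> 'x \<Rightarrow> real" where
  "sym_kernel K \<pi> x y = K x y / pmf \<pi> y"

locale reversible_ergodic_markov_process = markov_process M X K
  for M :: "'x::finite \<Rightarrow> 'w measure" and X :: "real \<Rightarrow> 'w \<Rightarrow> 'x" and K :: "'x \<Rightarrow> 'x \<Rightarrow> real" +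
  fixes \<pi> :: "'x pmf"
  assumes invariant: "invariant_law M X \<pi>"
    and invariant_unique: "\<And>\<mu>. invariant_law M X \<mu> \<Longrightarrow> \<mu> = \<pi>"
    and ergodic: "ergodic_law M X \<pi>"
    and pi_pos: "\<And>x. 0 < pmf \<pi> x"
    and reversible: "\<And>x y. sym_kernel K \<pi> x y = sym_kernel K \<pi> y x"

definition dirichlet ::
  "('x::finite \<Rightarrow> 'x \<Rightarrow> real) \<Rightarrow> 'x pmf \<Rightarrow> ('x \<Rightarrow> real) \<Rightarrow> ('x \<Rightarrow> real) \<Rightarrow> real" where
  "dirichlet K \<pi> f g = 1 / 2 * (\<Sum>x\<in>UNIV. \<Sum>y\<in>UNIV.
     (f x - f y) * (g x - g y) * sym_kernel K \<pi> x y * pmf \<pi> x * pmf \<pi> y)"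

text \<open>
  The infimum is taken in \<open>[0, \<infinity>]\<close>: it ranges over the empty set, and hence is \<open>\<infinity>\<close>, exactly when
  the state space is a singleton.
\<close>

definition nash_const ::
  "('x::finite \<Rightarrow> 'x \<Rightarrow> real) \<Rightarrow> 'x pmf \<Rightarrow> 'x pmf \<Rightarrow> real \<Rightarrow> ennreal" where
  "nash_const K \<pi> \<eta> p =
    (INF f \<in> {f. mean \<pi> f = 0 \<and> mean \<eta> (\<lambda>x. \<bar>f x\<bar>) > 0}.
       ennreal (dirichlet K \<pi> f f * sup_norm f powr ((2 - 2 * p) / p)
                / mean \<eta> (\<lambda>x. \<bar>f x\<bar>) powr (2 / p)))"

text \<open>Negative powers \<open>u\<^sup>-\<^sup>a\<close>, \<open>a > 0\<close>, on \<open>[0, \<infinity>]\<close>, sending \<open>0\<close> to \<open>\<infinity>\<close> and \<open>\<infinity>\<close> to \<open>0\<close>.\<close>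

definition neg_powr :: "ennreal \<Rightarrow> real \<Rightarrow> ennreal" where
  "neg_powr u a = (if u = 0 then \<infinity> else if u = \<infinity> then 0 else ennreal (enn2real u powr (- a)))"

definition dist_eq ::
  "('x::finite \<Rightarrow> 'w measure) \<Rightarrow> (real \<Rightarrow> 'w \<Rightarrow> 'x) \<Rightarrow> 'x pmf \<Rightarrow> 'x pmf \<Rightarrow> real \<Rightarrow> ennreal" where
  "dist_eq M X \<pi> \<eta> t =
    (SUP s \<in> {t..}. SUP f \<in> {f. sup_norm f \<le> 1}.
       ennreal (mean \<eta> (\<lambda>x. \<bar>semigroup_op M X s f x - mean \<pi> f\<bar>)))"

definition mixing_time ::
  "('x::finite \<Rightarrow> 'w measure) \<Rightarrow> (real \<Rightarrow> 'w \<Rightarrow> 'x) \<Rightarrow> 'x pmf \<Rightarrow> 'x pmf \<Rightarrow> real \<Rightarrow> ennreal" where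
  "mixing_time M X \<pi> \<eta> \<epsilon> = (INF t \<in> {t. 0 < t \<and> dist_eq M X \<pi> \<eta> t \<le> ennreal \<epsilon>}. ennreal t)"

text \<open>
  The same quantities with the test functions restricted to those with zero mean.  Centring a
  function with \<open>sup_norm f \<le> 1\<close> may double its norm, so that
  \<open>dist_eq_centred \<le> dist_eq \<le> 2 * dist_eq_centred\<close>.
\<close>

definition dist_eq_centred ::
  "('x::finite \<Rightarrow> 'w measure) \<Rightarrow> (real \<Rightarrow> 'w \<Rightarrow> 'x) \<Rightarrow> 'x pmf \<Rightarrow> 'x pmf \<Rightarrow> real \<Rightarrow> ennreal" where
  "dist_eq_centred M X \<pi> \<eta> t =
    (SUP s \<in> {t..}. SUP f \<in> {f. sup_norm f \<le> 1 \<and> mean \<pi> f = 0}.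
       ennreal (mean \<eta> (\<lambda>x. \<bar>semigroup_op M X s f x - mean \<pi> f\<bar>)))"

definition mixing_time_centred ::
  "('x::finite \<Rightarrow> 'w measure) \<Rightarrow> (real \<Rightarrow> 'w \<Rightarrow> 'x) \<Rightarrow> 'x pmf \<Rightarrow> 'x pmf \<Rightarrow> real \<Rightarrow> ennreal" where
  "mixing_time_centred M X \<pi> \<eta> \<epsilon> =
    (INF t \<in> {t. 0 < t \<and> dist_eq_centred M X \<pi> \<eta> t \<le> ennreal \<epsilon>}. ennreal t)"

definition dist_const :: "real \<Rightarrow> real \<Rightarrow> real" where
  "dist_const p p' = exp (- p' / 2) * (p / (2 - p)) powr (p * p' / (4 - 2 * p))"

definition time_const :: "real \<Rightarrow> real" where
  "time_const p = exp (- (2 - p) / 2) * (p / (2 - p)) powr (p / 2)"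

text \<open>
  For test functions that are not centred, \<open>dist_const\<close> and \<open>time_const\<close> have to be enlarged.  With
  \<open>p = 1\<close>, \<open>p' = 1/10\<close>, the chain on two points \<open>a\<close>, \<open>b\<close> with rates \<open>K a b = 1/10\<close>, \<open>K b a = 9/10\<close>
  and \<open>\<eta>\<close> the point mass at \<open>b\<close> has \<open>dist_eq = 1.62...\<close> at time \<open>1/10\<close>, whereas \<open>dist_const\<close>
  would give the bound \<open>1.27...\<close>.  The factor is \<open>1\<close> for \<open>p = p' = 1\<close>; the one for times is
  the factor for distances raised to the power \<open>(2 - p) / p'\<close>.
\<close>

definition dist_const_uncentred :: "real \<Rightarrow> real \<Rightarrow> real" where
  "dist_const_uncentred p p' = 2 powr (1 - p' / (2 - p)) * dist_const p p'"

definition time_const_uncentred :: "real \<Rightarrow> real \<Rightarrow> real" where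
  "time_const_uncentred p p' = 2 powr ((2 - p) / p' - 1) * time_const p"

end

(*
  For g = f - \<pi>(f), put g_s = P_s g, u(s) = \<pi>(g_s^2) and r = (2 - p) / p.  Since |P_s f| \<le> 1,
  u(s) \<le> \<pi>|g_s|, so the inequality defining the Nash constant of \<pi> turns u' = - 2 E(g_s, g_s) into
  u' \<le> - 2 c u^(2/p), hence u(s) \<le> (2 c r s)^(-1/r).  Reversibility gives
  E(g_t, g_t) \<le> u(t/2) / (e t), and the inequality for \<eta> bounds \<eta>|g_t| by a power of E(g_t, g_t).
  A bound B on the sup norm of g enters both Nash inequalities but not u \<le> \<pi>|g_s|; B = 1 gives the
  centred estimates and B = 2 the uncentred ones.
*)
theory Submission
  imports Defs
begin

text \<open>The energy at time t is the quantity to control because it bounds \<eta>|g_t| directly;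
  comparing \<eta>|g_t| with u would instead cost the density of \<eta> with respect to \<pi>. The
  interval [0, t] is cut in half: on the first half u decays at a rate that does not depend on its
  initial value, on the second half this smallness of u is converted into smallness of the energy.
  The factor exp (- p' / 2) is the 1 / e of the conversion raised to the power p' / 2, and the power
  of p / (2 - p) is r powr (- 1 / r) from the decay, raised to the same power. All this needs a
  differential equation for P_t at every t, while the jump rates are given only as right derivatives
  at time 0. The equation therefore has to be derived from the Markov property, including the left
  derivatives.\<close>

definition trans_prob :: "('x \<Rightarrow> 'w measure) \<Rightarrow> (real \<Rightarrow> 'w \<Rightarrow> 'x) \<Rightarrow> real \<Rightarrow> 'x \<Rightarrow> 'x \<Rightarrow> real" where
  "trans_prob M X t x y = measure (M x) (event (M x) X t y)"

text \<open>The differences \<open>f y - f x\<close> make the arbitrary diagonal of \<open>K\<close>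
  drop out, so that no normalisation of the row sums enters.\<close>

definition generator :: "('x::finite \<Rightarrow> 'x \<Rightarrow> real) \<Rightarrow> ('x \<Rightarrow> real) \<Rightarrow> 'x \<Rightarrow> real" where
  "generator K f x = (\<Sum>y\<in>UNIV. K x y * (f y - f x))"

section \<open>Means and sup norms on a finite state space\<close>

lemma mean_mono: "(\<And>x. f x \<le> g x) \<Longrightarrow> mean \<eta> f \<le> mean \<eta> g"
  unfolding mean_def by (intro sum_mono mult_left_mono) auto

lemma mean_nonneg: "(\<And>x. 0 \<le> f x) \<Longrightarrow> 0 \<le> mean \<eta> f"
  unfolding mean_def by (intro sum_nonneg) auto

lemma sum_pmf_UNIV: "(\<Sum>x\<in>UNIV. pmf \<eta> (x::'x::finite)) = 1"
  by (simp add: sum_pmf_eq_1)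

lemma mean_const: "mean \<eta> (\<lambda>_. c) = c"
  by (simp add: mean_def sum_distrib_right[symmetric] sum_pmf_UNIV)

lemma mean_diff: "mean \<eta> (\<lambda>x. f x - g x) = mean \<eta> f - mean \<eta> g"
  by (simp add: mean_def right_diff_distrib sum_subtractf)

lemma abs_le_sup_norm: "\<bar>f x\<bar> \<le> sup_norm f"
  unfolding sup_norm_def by (rule Max_ge) auto

lemma sup_norm_le_iff: "sup_norm f \<le> b \<longleftrightarrow> (\<forall>x. \<bar>f x\<bar> \<le> b)"
  unfolding sup_norm_def by (subst Max_le_iff) auto

lemma sup_norm_nonneg: "0 \<le> sup_norm f"
  by (rule order_trans[OF _ abs_le_sup_norm[of f undefined]]) simp

text \<open>Full support of \<pi> transfers nonvanishing from \<eta> to \<pi>. This supplies the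
  positivity of the squared norm at the final time that \<open>energy_decay\<close>
  requires.\<close>

lemma mean_square_pos:
  assumes "\<And>x. 0 < pmf \<pi> x" and "mean \<eta> (\<lambda>x. \<bar>g x\<bar>) \<noteq> 0"
  shows "0 < mean \<pi> (\<lambda>x. (g x)\<^sup>2)"
proof -
  obtain x where x: "g x \<noteq> 0"
    using assms(2) by (force simp: mean_def)
  have "0 < pmf \<pi> x * (g x)\<^sup>2"
    using x assms(1) by simp
  also have "\<dots> \<le> mean \<pi> (\<lambda>x. (g x)\<^sup>2)"
    unfolding mean_def by (rule member_le_sum) auto
  finally show ?thesis .
qed

lemma mean_Cauchy_Schwarz:
  "(mean \<pi> (\<lambda>x. f x * g x))\<^sup>2 \<le> mean \<pi> (\<lambda>x. (f x)\<^sup>2) * mean \<pi> (\<lambda>x. (g x)\<^sup>2)"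
  using Cauchy_Schwarz_ineq_sum[of "\<lambda>x. sqrt (pmf \<pi> x) * f x" "\<lambda>x. sqrt (pmf \<pi> x) * g x" UNIV]
  by (simp add: mean_def power_mult_distrib mult_ac)

section \<open>Differential inequalities on the half line\<close>

lemma derivative_within_nonneg_mono:
  assumes "0 \<le> a" "a \<le> b"
    and "\<And>s. a \<le> s \<Longrightarrow> s \<le> b \<Longrightarrow> (f has_real_derivative f' s) (at s within {0..})"
    and "\<And>s. a \<le> s \<Longrightarrow> s \<le> b \<Longrightarrow> 0 \<le> f' s"
  shows "f a \<le> (f b :: real)"
proof (cases "a = b")
  case False
  then have "\<exists>s\<in>{a<..<b}. f b - f a = f' s * (b - a)"
  proof (intro mvt_simple)
    fix s assume "a \<le> s" "s \<le> b"
    from assms(3)[OF this] show "(f has_derivative (*) (f' s)) (at s within {a..b})"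
      unfolding has_field_derivative_def by (rule has_derivative_subset) (use assms(1) in auto)
  qed (use assms(2) in simp)
  then obtain s where "s \<in> {a<..<b}" "f b - f a = f' s * (b - a)" ..
  moreover from this have "0 \<le> f' s * (b - a)"
    using assms(2,4) by simp
  ultimately show ?thesis by simp
qed simp

text \<open>The substitution v = u powr (- r) linearises the inequality: v' = - r * u powr (- r - 1)
  * u' is at least k * r. Dropping the nonnegative v 0 makes the bound independent of the initial
  value.\<close>

lemma power_law_decay:
  fixes u :: "real \<Rightarrow> real"
  assumes deriv: "\<And>s. 0 \<le> s \<Longrightarrow> (u has_real_derivative u' s) (at s within {0..})"
    and ineq: "\<And>s. 0 \<le> s \<Longrightarrow> u' s \<le> - k * u s powr (1 + r)"
    and nonneg: "\<And>s. 0 \<le> s \<Longrightarrow> 0 \<le> u s"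
    and pos: "0 < k" "0 < r" "0 < a"
  shows "u a \<le> (k * r * a) powr (- 1 / r)"
proof (cases "u a = 0")
  case False
  then have ua: "0 < u a"
    using nonneg[of a] pos by simp
  \<comment> \<open>u is nonincreasing, so positivity at a propagates to all earlier times; it is
    needed to differentiate the negative power.\<close>
  have upos: "0 < u s" if "0 \<le> s" "s \<le> a" for s
  proof -
    have "- u s \<le> - u a"
    proof (rule derivative_within_nonneg_mono[OF that])
      fix v assume "s \<le> v" "v \<le> a"
      with that show "((\<lambda>v. - u v) has_real_derivative - u' v) (at v within {0..})"
        by (intro DERIV_minus deriv) simp
      have "0 \<le> k * u v powr (1 + r)"
        using pos by simp
      then show "0 \<le> - u' v"
        using ineq[of v] \<open>s \<le> v\<close> that by simp
    qed
    with ua show ?thesis by simp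
  qed
  have "u 0 powr - r - k * r * 0 \<le> u a powr - r - k * r * a"
  proof (rule derivative_within_nonneg_mono[where f = "\<lambda>s. u s powr - r - k * r * s"])
    fix s assume s: "0 \<le> s" "s \<le> a"
    show "((\<lambda>s. u s powr - r - k * r * s) has_real_derivative
        - r * u s powr (- r - 1) * u' s - k * r) (at s within {0..})"
      using upos[OF s] by (auto intro!: derivative_eq_intros deriv s)
    have "k = u s powr (- r - 1) * (k * u s powr (1 + r))"
      using upos[OF s] by (simp add: powr_add[symmetric])
    also have "\<dots> \<le> u s powr (- r - 1) * - u' s"
      using ineq[OF s(1)] by (intro mult_left_mono) auto
    finally have "r * k \<le> r * (u s powr (- r - 1) * - u' s)"
      using pos by (intro mult_left_mono) auto
    then show "0 \<le> - r * u s powr (- r - 1) * u' s - k * r"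
      by (simp add: algebra_simps)
  qed (use pos in auto)
  then have "u 0 powr - r \<le> u a powr - r - k * r * a"
    by simp
  from order_trans[OF powr_ge_zero this] have "k * r * a \<le> u a powr - r"
    by simp
  then have "(u a powr - r) powr (- 1 / r) \<le> (k * r * a) powr (- 1 / r)"
    using pos by (intro powr_mono2') (auto simp: divide_simps)
  then show ?thesis
    using pos ua by (simp add: powr_powr)
qed simp

lemma mult_exp_minus_le: "x * exp (- x) \<le> exp (- 1 :: real)"
proof -
  have "x \<le> exp (x - 1)"
    using exp_ge_add_one_self[of "x - 1"] by simp
  then have "x * exp (- x) \<le> exp (x - 1) * exp (- x)"
    by (intro mult_right_mono) auto
  then show ?thesis
    by (simp flip: exp_add)
qed

text \<open>
  With \<open>u\<close> the squared norm and \<open>D\<close> the energy of a reversible flow, this replaces the spectral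
  estimate \<open>\<lambda> exp (- 2 \<lambda> t) \<le> 1 / (2 e t)\<close>: the Rayleigh quotient \<open>D / u\<close> is nonincreasing.
\<close>

lemma energy_decay:
  fixes u D S :: "real \<Rightarrow> real"
  assumes deriv: "\<And>s. 0 \<le> s \<Longrightarrow> (u has_real_derivative - 2 * D s) (at s within {0..})"
    and deriv_D: "\<And>s. 0 \<le> s \<Longrightarrow> (D has_real_derivative - 2 * S s) (at s within {0..})"
    and CS: "\<And>s. 0 \<le> s \<Longrightarrow> (D s)\<^sup>2 \<le> u s * S s"
    and nonneg: "\<And>s. 0 \<le> s \<Longrightarrow> 0 \<le> D s"
    and ab: "0 \<le> a" "a < b" and ub: "0 < u b"
  shows "D b \<le> u a / (2 * exp 1 * (b - a))"
proof -
  have upos: "0 < u s" if "a \<le> s" "s \<le> b" for s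
  proof -
    have "- u s \<le> - u b"
    proof (rule derivative_within_nonneg_mono[OF _ that(2)])
      fix v assume "s \<le> v" "v \<le> b"
      with that ab show "((\<lambda>v. - u v) has_real_derivative - (- 2 * D v)) (at v within {0..})"
        by (intro DERIV_minus deriv) simp
      show "0 \<le> - (- 2 * D v)"
        using nonneg[of v] \<open>s \<le> v\<close> that ab by simp
    qed (use that ab in simp)
    with ub show ?thesis by simp
  qed
  \<comment> \<open>The Rayleigh quotient at the right end point. As the quotient is nonincreasing,
    R bounds it from below on all of [a, b].\<close>
  define R where "R = D b / u b"
  have R: "R * u s \<le> D s" if "a \<le> s" "s \<le> b" for s
  proof -
    have "- (D s / u s) \<le> - (D b / u b)"
    proof (rule derivative_within_nonneg_mono[OF _ that(2)])
      fix v assume v: "s \<le> v" "v \<le> b"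
      then have v': "a \<le> v" "0 \<le> v"
        using that ab by auto
      show "((\<lambda>v. - (D v / u v)) has_real_derivative
          - ((- 2 * S v * u v - D v * (- 2 * D v)) / (u v * u v))) (at v within {0..})"
        using upos[OF v'(1) v(2)] v'
        by (intro DERIV_minus DERIV_divide deriv deriv_D) auto
      show "0 \<le> - ((- 2 * S v * u v - D v * (- 2 * D v)) / (u v * u v))"
        using CS[OF v'(2)] upos[OF v'(1) v(2)]
        by (simp add: divide_simps power2_eq_square algebra_simps)
    qed (use that ab in simp)
    then show ?thesis
      using upos[OF that] by (simp add: R_def field_simps)
  qed
  have decreasing: "- (u a * exp (2 * R * (a - a))) \<le> - (u b * exp (2 * R * (b - a)))"
  proof (rule derivative_within_nonneg_mono[where f = "\<lambda>s. - (u s * exp (2 * R * (s - a)))"])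
    fix s assume s: "a \<le> s" "s \<le> b"
    show "((\<lambda>s. - (u s * exp (2 * R * (s - a)))) has_real_derivative
        2 * exp (2 * R * (s - a)) * (D s - R * u s)) (at s within {0..})"
      using s ab by (auto intro!: derivative_eq_intros deriv simp: algebra_simps)
    show "0 \<le> 2 * exp (2 * R * (s - a)) * (D s - R * u s)"
      using R[OF s] by simp
  qed (use ab in auto)
  \<comment> \<open>Since D b = R * u b, the rate R enters the final bound only through y * exp (-
    y), whose maximum is exp (- 1); this eliminates R.\<close>
  define y where "y = 2 * R * (b - a)"
  have "u b * exp y \<le> u a"
    using decreasing by (simp add: y_def)
  then have le: "u b \<le> u a * exp (- y)"
    by (simp add: exp_minus field_simps)
  have R0: "0 \<le> R"
    using nonneg[of b] ab ub by (simp add: R_def)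
  have "D b * (2 * (b - a)) = y * u b"
    using ub by (simp add: R_def y_def)
  also have "\<dots> \<le> y * (u a * exp (- y))"
    using R0 ab by (intro mult_left_mono le) (auto simp: y_def)
  also have "\<dots> = u a * (y * exp (- y))"
    by simp
  also have "\<dots> \<le> u a * exp (- 1)"
    using upos[of a] ab by (intro mult_left_mono mult_exp_minus_le) auto
  finally show ?thesis
    using ab by (simp add: exp_minus field_simps)
qed

text \<open>Write (h - c)^2 = h * (h - c) - c * (h - c) with c the mean of h; the last term has mean
  0. Thus the bound on h itself enters rather than the bound 2 on h - c, and centring costs no
  factor here.\<close>

lemma variance_le_mean_abs_deviation:
  assumes "\<And>x. \<bar>h x\<bar> \<le> 1"
  shows "mean \<pi> (\<lambda>x. (h x - mean \<pi> h)\<^sup>2) \<le> mean \<pi> (\<lambda>x. \<bar>h x - mean \<pi> h\<bar>)"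
proof -
  define c where "c = mean \<pi> h"
  have "mean \<pi> (\<lambda>x. (h x - c)\<^sup>2) = mean \<pi> (\<lambda>x. h x * (h x - c) - c * (h x - c))"
    by (simp add: power2_eq_square algebra_simps)
  also have "\<dots> = mean \<pi> (\<lambda>x. h x * (h x - c)) - c * mean \<pi> (\<lambda>x. h x - c)"
    by (subst mean_diff) (simp add: mean_def sum_distrib_left mult_ac)
  also have "mean \<pi> (\<lambda>x. h x - c) = 0"
    by (simp add: mean_diff mean_const c_def)
  also have "mean \<pi> (\<lambda>x. h x * (h x - c)) \<le> mean \<pi> (\<lambda>x. \<bar>h x - c\<bar>)"
  proof (rule mean_mono)
    fix x
    have "h x * (h x - c) \<le> \<bar>h x\<bar> * \<bar>h x - c\<bar>"
      by (simp flip: abs_mult)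
    also have "\<dots> \<le> 1 * \<bar>h x - c\<bar>"
      using assms by (intro mult_right_mono) auto
    finally show "h x * (h x - c) \<le> \<bar>h x - c\<bar>" by simp
  qed
  finally show ?thesis by (simp add: c_def)
qed

section \<open>The semigroup of the process and its backward equation\<close>

context markov_process
begin

lemma event_sets: "0 \<le> t \<Longrightarrow> event (M x) X t y \<in> sets (M x)"
  using measurable_sets[OF measurable_process, of t "{y}" x]
  by (simp add: event_def vimage_def Int_def conj_commute)

lemma trans_prob_nonneg: "0 \<le> trans_prob M X t x y"
  by (simp add: trans_prob_def)

lemma measure_split_event:
  assumes "0 \<le> t" "A \<in> sets (M x)"
  shows "measure (M x) A = (\<Sum>y\<in>UNIV. measure (M x) (event (M x) X t y \<inter> A))"
proof -
  interpret prob_space "M x" by (rule prob_space_law)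
  have "A = (\<Union>y. event (M x) X t y \<inter> A)"
    using sets.sets_into_space[OF assms(2)] by (auto simp: event_def)
  moreover have "disjoint_family (\<lambda>y. event (M x) X t y \<inter> A)"
    by (auto simp: disjoint_family_on_def event_def)
  then have "measure (M x) (\<Union>y. event (M x) X t y \<inter> A) = (\<Sum>y\<in>UNIV. measure (M x) (event (M x) X t y \<inter> A))"
    using assms event_sets by (intro finite_measure_finite_Union) auto
  ultimately show ?thesis
    by simp
qed

lemma sum_trans_prob: "0 \<le> t \<Longrightarrow> (\<Sum>y\<in>UNIV. trans_prob M X t x y) = 1"
  using measure_split_event[of t "space (M x)" x] prob_space.prob_space[OF prob_space_law, of x]
  by (simp add: trans_prob_def sets.Int_space_eq2 event_sets)

lemma Chapman_Kolmogorov: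
  assumes "0 \<le> s" "0 \<le> t"
  shows "trans_prob M X (s + t) x z = (\<Sum>y\<in>UNIV. trans_prob M X s x y * trans_prob M X t y z)"
proof -
  \<comment> \<open>Taking the whole space as the past event turns the Markov property into a
    statement about the times s and s + t only.\<close>
  have "space (M x) \<in> past (M x) X s"
    unfolding past_def by (rule sigma_sets_top)
  from markov[OF assms this] show ?thesis
    using measure_split_event[OF assms(1) event_sets[of "s + t" x z]] assms
    by (simp add: trans_prob_def sets.Int_space_eq1 event_sets)
qed

lemma semigroup_op_eq:
  assumes "0 \<le> t"
  shows "semigroup_op M X t f x = (\<Sum>y\<in>UNIV. trans_prob M X t x y * f y)"
proof -
  interpret prob_space "M x" by (rule prob_space_law)
  have "semigroup_op M X t f x = (\<integral>\<omega>. (\<Sum>y\<in>UNIV. indicator (event (M x) X t y) \<omega> * f y) \<partial>M x)"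
    unfolding semigroup_op_def
  proof (intro Bochner_Integration.integral_cong refl)
    fix \<omega> assume "\<omega> \<in> space (M x)"
    then have "(\<Sum>y\<in>UNIV. indicator (event (M x) X t y) \<omega> * f y)
        = (\<Sum>y\<in>UNIV. if X t \<omega> = y then f y else 0)"
      by (intro sum.cong) (auto simp: event_def indicator_def)
    then show "f (X t \<omega>) = (\<Sum>y\<in>UNIV. indicator (event (M x) X t y) \<omega> * f y)"
      by simp
  qed
  also have "\<dots> = (\<Sum>y\<in>UNIV. (\<integral>\<omega>. indicator (event (M x) X t y) \<omega> * f y \<partial>M x))"
    using event_sets[OF assms] by (intro Bochner_Integration.integral_sum) (auto simp: less_top[symmetric])
  also have "\<dots> = (\<Sum>y\<in>UNIV. trans_prob M X t x y * f y)"
    using event_sets[OF assms] by (simp add: trans_prob_def)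
  finally show ?thesis .
qed

lemma semigroup_op_0: "semigroup_op M X 0 f x = f x"
proof -
  interpret prob_space "M x" by (rule prob_space_law)
  have "semigroup_op M X 0 f x = (\<integral>\<omega>. f x \<partial>M x)"
    unfolding semigroup_op_def
  proof (rule integral_cong_AE)
    show "(\<lambda>\<omega>. f (X 0 \<omega>)) \<in> borel_measurable (M x)"
      using measurable_process[of 0 x] by measurable
    show "AE \<omega> in M x. f (X 0 \<omega>) = f x"
      using start[of x] by eventually_elim simp
  qed simp
  then show ?thesis by (simp add: prob_space)
qed

lemma semigroup_op_add:
  assumes "0 \<le> s" "0 \<le> t"
  shows "semigroup_op M X (s + t) f x = semigroup_op M X s (semigroup_op M X t f) x"
proof -
  have "semigroup_op M X (s + t) f x
      = (\<Sum>z\<in>UNIV. \<Sum>y\<in>UNIV. trans_prob M X s x y * trans_prob M X t y z * f z)"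
    using assms by (simp add: semigroup_op_eq Chapman_Kolmogorov sum_distrib_right)
  also have "\<dots> = semigroup_op M X s (semigroup_op M X t f) x"
    using assms by (subst sum.swap) (simp add: semigroup_op_eq sum_distrib_left mult.assoc)
  finally show ?thesis .
qed

text \<open>Each row of the transition matrix sums to 1. With \<open>c = f x\<close> the diagonal
  term vanishes, which leaves only the off-diagonal probabilities, whose behaviour at time 0 is what
  \<open>jump_rate\<close> describes.\<close>

lemma semigroup_op_diff_self:
  assumes "0 \<le> t"
  shows "semigroup_op M X t f x - c = (\<Sum>y\<in>UNIV. trans_prob M X t x y * (f y - c))"
  using assms
  by (simp add: semigroup_op_eq right_diff_distrib sum_subtractf sum_distrib_right[symmetric]
      sum_trans_prob)

lemma semigroup_op_centre:
  assumes "0 \<le> t"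
  shows "semigroup_op M X t (\<lambda>y. f y - c) x = semigroup_op M X t f x - c"
  using semigroup_op_diff_self[OF assms, of f x c] semigroup_op_eq[OF assms] by simp

lemma sup_norm_semigroup_op:
  assumes "0 \<le> t"
  shows "sup_norm (semigroup_op M X t f) \<le> sup_norm f"
  unfolding sup_norm_le_iff[of "semigroup_op M X t f"]
proof
  fix x
  have "\<bar>semigroup_op M X t f x\<bar> \<le> (\<Sum>y\<in>UNIV. \<bar>trans_prob M X t x y * f y\<bar>)"
    unfolding semigroup_op_eq[OF assms] by (rule sum_abs)
  also have "\<dots> \<le> (\<Sum>y\<in>UNIV. trans_prob M X t x y * sup_norm f)"
    by (intro sum_mono)
       (simp add: abs_mult trans_prob_nonneg mult_left_mono abs_le_sup_norm)
  also have "\<dots> = sup_norm f"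
    by (simp add: sum_trans_prob[OF assms] flip: sum_distrib_right)
  finally show "\<bar>semigroup_op M X t f x\<bar> \<le> sup_norm f" .
qed

lemma trans_prob_0: "x \<noteq> y \<Longrightarrow> trans_prob M X 0 x y = 0"
  using semigroup_op_0[of "indicator {y}" x]
  by (simp add: semigroup_op_eq indicator_def if_distrib[of "\<lambda>a. _ * a"] cong: if_cong)

lemma jump_rate_quotient:
  assumes "x \<noteq> y"
  shows "((\<lambda>h. trans_prob M X h x y / h) \<longlongrightarrow> K x y) (at_right 0)"
proof -
  have "((\<lambda>h. trans_prob M X h x y / h) \<longlongrightarrow> K x y) (at 0 within {0..})"
    using jump_rate[OF assms] trans_prob_0[OF assms]
    by (simp add: has_field_derivative_iff trans_prob_def)
  then show ?thesis
    by (rule tendsto_within_subset) auto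
qed

text \<open>The sign of the rates is not postulated; it is inherited from the quotients of
  probabilities that converge to them. It makes the Dirichlet form nonnegative.\<close>

lemma jump_rate_nonneg:
  assumes "x \<noteq> y"
  shows "0 \<le> K x y"
proof (rule tendsto_lowerbound[OF jump_rate_quotient[OF assms]])
  show "\<forall>\<^sub>F h in at_right 0. 0 \<le> trans_prob M X h x y / h"
    using eventually_at_right_less[of "0::real"]
    by eventually_elim (simp add: trans_prob_nonneg)
qed simp

lemma trans_prob_tendsto_0:
  assumes "x \<noteq> y"
  shows "((\<lambda>h. trans_prob M X h x y) \<longlongrightarrow> 0) (at_right 0)"
proof -
  have "((\<lambda>h. h * (trans_prob M X h x y / h)) \<longlongrightarrow> 0 * K x y) (at_right 0)"
    by (intro tendsto_intros jump_rate_quotient[OF assms])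
  moreover have "\<forall>\<^sub>F h in at_right 0. h * (trans_prob M X h x y / h) = trans_prob M X h x y"
    using eventually_at_right_less[of "0::real"] by eventually_elim simp
  ultimately show ?thesis
    using Lim_transform_eventually by fastforce
qed

text \<open>The function may vary with h so that both one-sided derivatives are covered: a constant
  family gives the right derivative at t, the family P_(t - h) f the left one.\<close>

lemma semigroup_op_difference_quotient:
  assumes "\<And>y. ((\<lambda>h. \<phi> h y) \<longlongrightarrow> f y) (at_right 0)"
  shows "((\<lambda>h. (semigroup_op M X h (\<phi> h) x - \<phi> h x) / h) \<longlongrightarrow> generator K f x) (at_right 0)"
proof -
  have "((\<lambda>h. trans_prob M X h x y / h * (\<phi> h y - \<phi> h x)) \<longlongrightarrow> K x y * (f y - f x)) (at_right 0)" for y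
  proof (cases "x = y")
    case False
    then show ?thesis by (intro tendsto_intros assms jump_rate_quotient)
  qed simp
  then have "((\<lambda>h. \<Sum>y\<in>UNIV. trans_prob M X h x y / h * (\<phi> h y - \<phi> h x)) \<longlongrightarrow> generator K f x) (at_right 0)"
    unfolding generator_def by (intro tendsto_sum)
  moreover have "\<forall>\<^sub>F h in at_right 0. (\<Sum>y\<in>UNIV. trans_prob M X h x y / h * (\<phi> h y - \<phi> h x))
      = (semigroup_op M X h (\<phi> h) x - \<phi> h x) / h"
    using eventually_at_right_less[of "0::real"]
    by eventually_elim (simp add: semigroup_op_diff_self sum_divide_distrib)
  ultimately show ?thesis
    by (rule Lim_transform_eventually)
qed

text \<open>By the semigroup law P_t f = P_h P_(t - h) f. Hence P_t f - P_(t - h) f at x is a sum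
  over y \<noteq> x of terms at most 2 * \<open>sup_norm f\<close> times the probability of being at
  y at time h, which tends to 0.\<close>

lemma semigroup_op_left_continuous:
  assumes "0 < t"
  shows "((\<lambda>h. semigroup_op M X (t - h) f x) \<longlongrightarrow> semigroup_op M X t f x) (at_right 0)"
proof -
  have small: "\<forall>\<^sub>F h in at_right (0::real). 0 < h \<and> h < t"
    using assms eventually_at_right[of 0 t] by (auto intro: exI[of _ t])
  have "((\<lambda>h. trans_prob M X h x y * (semigroup_op M X (t - h) f y - semigroup_op M X (t - h) f x))
      \<longlongrightarrow> 0) (at_right 0)" for y
  proof (cases "x = y")
    case False
    show ?thesis
    proof (rule Lim_null_comparison)
      show "((\<lambda>h. trans_prob M X h x y * (2 * sup_norm f)) \<longlongrightarrow> 0) (at_right 0)"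
        using tendsto_mult_left_zero[OF trans_prob_tendsto_0[OF False]] .
      show "\<forall>\<^sub>F h in at_right 0.
          norm (trans_prob M X h x y * (semigroup_op M X (t - h) f y - semigroup_op M X (t - h) f x))
          \<le> trans_prob M X h x y * (2 * sup_norm f)"
        using small
      proof eventually_elim
        case (elim h)
        then have "\<bar>semigroup_op M X (t - h) f z\<bar> \<le> sup_norm f" for z
          using sup_norm_semigroup_op[of "t - h" f] abs_le_sup_norm[of "semigroup_op M X (t - h) f" z]
          by simp
        from this[of x] this[of y] show ?case
          by (auto simp: abs_mult trans_prob_nonneg intro!: mult_left_mono)
      qed
    qed
  qed simp
  then have "((\<lambda>h. \<Sum>y\<in>UNIV. trans_prob M X h x y *
      (semigroup_op M X (t - h) f y - semigroup_op M X (t - h) f x)) \<longlongrightarrow> 0) (at_right 0)"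
    using tendsto_sum[where I = UNIV] by fastforce
  then have "((\<lambda>h. semigroup_op M X t f x - (\<Sum>y\<in>UNIV. trans_prob M X h x y *
      (semigroup_op M X (t - h) f y - semigroup_op M X (t - h) f x))) \<longlongrightarrow> semigroup_op M X t f x - 0)
      (at_right 0)"
    by (intro tendsto_intros)
  moreover have "\<forall>\<^sub>F h in at_right 0. semigroup_op M X t f x - (\<Sum>y\<in>UNIV. trans_prob M X h x y *
      (semigroup_op M X (t - h) f y - semigroup_op M X (t - h) f x)) = semigroup_op M X (t - h) f x"
    using small
  proof eventually_elim
    case (elim h)
    then show ?case
      using semigroup_op_add[of h "t - h" f x]
        semigroup_op_diff_self[of h "semigroup_op M X (t - h) f" x "semigroup_op M X (t - h) f x"]
      by simp
  qed
  ultimately show ?thesis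
    using Lim_transform_eventually by fastforce
qed

lemma semigroup_op_right_derivative:
  assumes "0 \<le> t"
  shows "((\<lambda>h. (semigroup_op M X (t + h) f x - semigroup_op M X t f x) / h)
    \<longlongrightarrow> generator K (semigroup_op M X t f) x) (at_right 0)"
proof -
  have "\<forall>\<^sub>F h in at_right 0.
      (semigroup_op M X h (semigroup_op M X t f) x - semigroup_op M X t f x) / h
      = (semigroup_op M X (t + h) f x - semigroup_op M X t f x) / h"
    using eventually_at_right_less[of "0::real"]
    by eventually_elim (simp add: assms semigroup_op_add[symmetric] add.commute)
  from tendsto_cong[OF this] show ?thesis
    using semigroup_op_difference_quotient[of "\<lambda>_. semigroup_op M X t f" "semigroup_op M X t f" x]
    by simp
qed

lemma semigroup_op_left_derivative:
  assumes "0 < t"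
  shows "((\<lambda>h. (semigroup_op M X (t + h) f x - semigroup_op M X t f x) / h)
    \<longlongrightarrow> generator K (semigroup_op M X t f) x) (at_left 0)"
proof -
  have small: "\<forall>\<^sub>F h in at_right (0::real). 0 < h \<and> h < t"
    using assms eventually_at_right[of 0 t] by (auto intro: exI[of _ t])
  then have "\<forall>\<^sub>F h in at_right 0.
      (semigroup_op M X h (semigroup_op M X (t - h) f) x - semigroup_op M X (t - h) f x) / h
      = (semigroup_op M X (t + - h) f x - semigroup_op M X t f x) / - h"
  proof eventually_elim
    case (elim h)
    then show ?case
      using semigroup_op_add[of h "t - h" f x] by (simp add: field_simps)
  qed
  from tendsto_cong[OF this] show ?thesis
    using semigroup_op_difference_quotient[where f = "semigroup_op M X t f" and x = x
        and \<phi> = "\<lambda>h. semigroup_op M X (t - h) f", OF semigroup_op_left_continuous[OF assms]]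
    by (simp add: filterlim_at_left_to_right)
qed

text \<open>Kolmogorov's backward equation. The derivative is taken within \<open>{0..}\<close>
  because the process is uncontrolled at negative times: at 0 it is one-sided, at t > 0 it is the
  ordinary derivative.\<close>

lemma semigroup_op_has_derivative:
  assumes "0 \<le> t"
  shows "((\<lambda>t. semigroup_op M X t f x) has_real_derivative generator K (semigroup_op M X t f) x)
    (at t within {0..})"
proof (cases "t = 0")
  case True
  have "at (0::real) within {0..} = at_right 0"
    by (rule at_within_Ici_at_right)
  then show ?thesis
    using semigroup_op_right_derivative[of 0 f x] True
    by (simp add: has_field_derivative_iff)
next
  case False
  then have "0 < t" using assms by simp
  have "((\<lambda>t. semigroup_op M X t f x) has_real_derivative generator K (semigroup_op M X t f) x) (at t)"
    unfolding DERIV_def filterlim_at_split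
    using semigroup_op_right_derivative[OF assms] semigroup_op_left_derivative[OF \<open>0 < t\<close>] by simp
  then show ?thesis
    by (rule has_field_derivative_at_within)
qed

end

section \<open>The Dirichlet form and the Nash inequality\<close>

lemma dirichlet_nonneg:
  assumes "\<And>x y. x \<noteq> y \<Longrightarrow> 0 \<le> K x y"
  shows "0 \<le> dirichlet K \<pi> f f"
proof -
  have "0 \<le> (f x - f y) * (f x - f y) * sym_kernel K \<pi> x y * pmf \<pi> x * pmf \<pi> y" for x y
    using assms[of x y] by (cases "x = y") (auto simp: sym_kernel_def simp flip: power2_eq_square)
  then show ?thesis
    by (auto simp: dirichlet_def intro!: sum_nonneg)
qed

text \<open>The infimum covers only functions with \<eta>|g| > 0; for the others the left side is 0
  because \<open>0 powr a = 0\<close>. The exponent of the sup norm is nonnegative for p \<le> 1,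
  which permits passing from \<open>sup_norm g\<close> to the bound B.\<close>

lemma nash_inequality:
  assumes L: "nash_const K \<pi> \<eta> p = ennreal L" "0 < L"
    and p: "0 < p" "p \<le> 1"
    and K: "\<And>x y. x \<noteq> y \<Longrightarrow> 0 \<le> K x y"
    and g: "mean \<pi> g = 0" "sup_norm g \<le> B"
  shows "L * mean \<eta> (\<lambda>x. \<bar>g x\<bar>) powr (2 / p) \<le> dirichlet K \<pi> g g * B powr ((2 - 2 * p) / p)"
proof (cases "mean \<eta> (\<lambda>x. \<bar>g x\<bar>) = 0")
  case True
  then show ?thesis
    using dirichlet_nonneg[of K \<pi> g] K by simp
next
  case False
  define m where "m = mean \<eta> (\<lambda>x. \<bar>g x\<bar>)"
  have m: "0 < m"
    using False mean_nonneg[of "\<lambda>x. \<bar>g x\<bar>" \<eta>] by (simp add: m_def)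
  have "ennreal L \<le> ennreal (dirichlet K \<pi> g g * sup_norm g powr ((2 - 2 * p) / p) / m powr (2 / p))"
    unfolding L(1)[symmetric] nash_const_def m_def
    by (rule INF_lower) (use g m in \<open>simp add: m_def\<close>)
  then have "L \<le> dirichlet K \<pi> g g * sup_norm g powr ((2 - 2 * p) / p) / m powr (2 / p)"
    using L(2) by (simp add: ennreal_le_iff2)
  then have "L * m powr (2 / p) \<le> dirichlet K \<pi> g g * sup_norm g powr ((2 - 2 * p) / p)"
    using m by (simp add: field_simps)
  also have "\<dots> \<le> dirichlet K \<pi> g g * B powr ((2 - 2 * p) / p)"
    using p g sup_norm_nonneg[of g] dirichlet_nonneg[of K \<pi> g] K
    by (intro mult_left_mono powr_mono2) auto
  finally show ?thesis
    by (simp add: m_def)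
qed

section \<open>Reversible dynamics and the L1 estimate\<close>

context reversible_ergodic_markov_process
begin

text \<open>Summation by parts. The flow w x y = \<pi>(x) K(x, y) is symmetric by reversibility, so
  interchanging x and y shows that the terms with f x and those with f y contribute equally to the
  form.\<close>

lemma mean_generator: "mean \<pi> (\<lambda>x. f x * generator K g x) = - dirichlet K \<pi> f g"
proof -
  define w where "w x y = K x y * pmf \<pi> x" for x y
  have w: "sym_kernel K \<pi> x y * pmf \<pi> x * pmf \<pi> y = w x y" for x y
    using pi_pos[of y] by (simp add: sym_kernel_def w_def)
  have sym: "w x y = w y x" for x y
    using reversible[of x y] w[of x y] w[of y x] by (simp add: mult_ac)
  have "(\<Sum>x\<in>UNIV. \<Sum>y\<in>UNIV. f y * (g x - g y) * w x y)
      = (\<Sum>y\<in>UNIV. \<Sum>x\<in>UNIV. f y * (g x - g y) * w x y)"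
    by (rule sum.swap)
  also have "\<dots> = (\<Sum>x\<in>UNIV. \<Sum>y\<in>UNIV. f x * (g y - g x) * w x y)"
    by (simp add: sym)
  finally have swap: "(\<Sum>x\<in>UNIV. \<Sum>y\<in>UNIV. f y * (g x - g y) * w x y)
      = (\<Sum>x\<in>UNIV. \<Sum>y\<in>UNIV. f x * (g y - g x) * w x y)" .
  have "2 * dirichlet K \<pi> f g = (\<Sum>x\<in>UNIV. \<Sum>y\<in>UNIV. (f x - f y) * (g x - g y) * w x y)"
    by (simp add: dirichlet_def mult.assoc flip: w)
  also have "\<dots> = (\<Sum>x\<in>UNIV. \<Sum>y\<in>UNIV.
      - (f x * (g y - g x) * w x y) - f y * (g x - g y) * w x y)"
    by (intro sum.cong refl) (simp add: algebra_simps)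
  also have "\<dots> = - 2 * (\<Sum>x\<in>UNIV. \<Sum>y\<in>UNIV. f x * (g y - g x) * w x y)"
    by (simp add: sum_subtractf sum_negf swap)
  also have "(\<Sum>x\<in>UNIV. \<Sum>y\<in>UNIV. f x * (g y - g x) * w x y)
      = mean \<pi> (\<lambda>x. f x * generator K g x)"
    by (simp add: mean_def generator_def sum_distrib_left w_def mult_ac)
  finally show ?thesis by simp
qed

lemma dirichlet_commute: "dirichlet K \<pi> f g = dirichlet K \<pi> g f"
  by (simp add: dirichlet_def mult_ac)

lemma generator_self_adjoint:
  "mean \<pi> (\<lambda>x. f x * generator K g x) = mean \<pi> (\<lambda>x. g x * generator K f x)"
  by (simp add: mean_generator dirichlet_commute)

lemma square_norm_derivative:
  assumes "0 \<le> s"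
  shows "((\<lambda>s. mean \<pi> (\<lambda>x. (semigroup_op M X s g x)\<^sup>2)) has_real_derivative
    - 2 * dirichlet K \<pi> (semigroup_op M X s g) (semigroup_op M X s g)) (at s within {0..})"
proof -
  have "((\<lambda>s. mean \<pi> (\<lambda>x. (semigroup_op M X s g x)\<^sup>2)) has_real_derivative
      2 * mean \<pi> (\<lambda>x. semigroup_op M X s g x * generator K (semigroup_op M X s g) x))
      (at s within {0..})"
    unfolding mean_def
    by (auto intro!: derivative_eq_intros semigroup_op_has_derivative assms sum.cong
        simp: sum_distrib_left algebra_simps)
  then show ?thesis
    by (simp add: mean_generator)
qed

text \<open>The energy equals - \<pi>(g_s G_s), where G_s is the generator applied to g_s.
  Differentiation commutes with the generator, a finite sum with constant coefficients, and
  self-adjointness makes the two terms of the product rule equal.\<close>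

lemma energy_derivative:
  assumes "0 \<le> s"
  shows "((\<lambda>s. dirichlet K \<pi> (semigroup_op M X s g) (semigroup_op M X s g)) has_real_derivative
    - 2 * mean \<pi> (\<lambda>x. (generator K (semigroup_op M X s g) x)\<^sup>2)) (at s within {0..})"
proof -
  define G where "G s = generator K (semigroup_op M X s g)" for s
  have "((\<lambda>s. G s x) has_real_derivative generator K (G s) x) (at s within {0..})" for x
    unfolding G_def generator_def
    by (auto intro!: derivative_eq_intros semigroup_op_has_derivative[unfolded generator_def] assms
        simp: mult.commute)
  then have "((\<lambda>s. - mean \<pi> (\<lambda>x. semigroup_op M X s g x * G s x)) has_real_derivative
      - (mean \<pi> (\<lambda>x. (G s x)\<^sup>2) + mean \<pi> (\<lambda>x. semigroup_op M X s g x * generator K (G s) x)))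
      (at s within {0..})"
    unfolding mean_def
    by (auto intro!: derivative_eq_intros semigroup_op_has_derivative assms
        simp: sum.distrib[symmetric] G_def power2_eq_square algebra_simps)
  also have "mean \<pi> (\<lambda>x. semigroup_op M X s g x * generator K (G s) x) = mean \<pi> (\<lambda>x. (G s x)\<^sup>2)"
    unfolding generator_self_adjoint[of _ "G s"] by (simp add: G_def power2_eq_square)
  finally show ?thesis
    by (simp add: G_def mean_generator)
qed

text \<open>\<open>square_le\<close> is a separate hypothesis because the bound B on g alone would
  yield it only with an additional factor B.\<close>

lemma L1_bound:
  assumes g: "mean \<pi> g = 0" "sup_norm g \<le> B"
    and square_le: "\<And>s. 0 \<le> s \<Longrightarrow>
      mean \<pi> (\<lambda>x. (semigroup_op M X s g x)\<^sup>2) \<le> mean \<pi> (\<lambda>x. \<bar>semigroup_op M X s g x\<bar>)"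
    and B: "0 < B"
    and L: "nash_const K \<pi> \<pi> p = ennreal L" "0 < L"
    and N: "nash_const K \<pi> \<eta> p' = ennreal N" "0 < N"
    and p: "0 < p" "p \<le> 1" and p': "0 < p'" "p' \<le> 1"
    and t: "0 < t"
  shows "mean \<eta> (\<lambda>x. \<bar>semigroup_op M X t g x\<bar>) \<le> B powr (1 - p' / (2 - p)) * dist_const p p' *
    N powr (- (p' / 2)) * L powr (- (p * p' / (4 - 2 * p))) * t powr (- p' / (2 - p))"
    (is "?m \<le> ?rhs")
proof (cases "?m = 0")
  case True
  then show ?thesis
    using B L N t by (simp add: dist_const_def)
next
  case False
  then have m: "0 < ?m"
    using mean_nonneg[of "\<lambda>x. \<bar>semigroup_op M X t g x\<bar>" \<eta>] by simp
  define u where "u s = mean \<pi> (\<lambda>x. (semigroup_op M X s g x)\<^sup>2)" for s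
  define D where "D s = dirichlet K \<pi> (semigroup_op M X s g) (semigroup_op M X s g)" for s
  \<comment> \<open>c absorbs the sup norm factor of the Nash inequality for \<pi>, which then reads
    c * u powr (2 / p) \<le> D; r is chosen so that 1 + r = 2 / p.\<close>
  define c where "c = L * B powr (- ((2 - 2 * p) / p))"
  define r where "r = (2 - p) / p"
  have c: "0 < c" and r: "0 < r"
    using B L p by (auto simp: c_def r_def)
  have mean0: "mean \<pi> (semigroup_op M X s g) = 0" if "0 \<le> s" for s
    using invariant g that by (simp add: invariant_law_def)
  have sup: "sup_norm (semigroup_op M X s g) \<le> B" if "0 \<le> s" for s
    using sup_norm_semigroup_op[OF that, of g] g by simp
  have D_nonneg: "0 \<le> D s" for s
    by (simp add: D_def dirichlet_nonneg jump_rate_nonneg)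
  have u_nonneg: "0 \<le> u s" for s
    by (simp add: u_def mean_nonneg)
  \<comment> \<open>The factor 2 from u' = - 2 D cancels against the half time, which leaves c * r *
    t.\<close>
  have "u (t / 2) \<le> (2 * c * r * (t / 2)) powr (- 1 / r)"
  proof (rule power_law_decay)
    fix s :: real assume s: "0 \<le> s"
    show "(u has_real_derivative - 2 * D s) (at s within {0..})"
      using square_norm_derivative[OF s, of g] by (simp add: u_def[abs_def] D_def)
    have "L * u s powr (2 / p) \<le> L * mean \<pi> (\<lambda>x. \<bar>semigroup_op M X s g x\<bar>) powr (2 / p)"
      using square_le[OF s] u_nonneg[of s] L p
      by (intro mult_left_mono powr_mono2) (auto simp: u_def)
    also have "\<dots> \<le> D s * B powr ((2 - 2 * p) / p)"
      unfolding D_def by (rule nash_inequality[OF L p jump_rate_nonneg mean0[OF s] sup[OF s]])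
    finally have "c * u s powr (2 / p) \<le> D s"
      using B by (simp add: c_def powr_minus field_simps)
    moreover have "1 + r = 2 / p"
      using p by (simp add: r_def field_simps)
    ultimately show "- 2 * D s \<le> - (2 * c) * u s powr (1 + r)"
      by simp
  qed (use u_nonneg c r t in auto)
  then have decay: "u (t / 2) \<le> (c * r * t) powr (- 1 / r)"
    by (simp add: mult.assoc)
  have "D t \<le> u (t / 2) / (2 * exp 1 * (t - t / 2))"
  proof (rule energy_decay)
    fix s :: real assume s: "0 \<le> s"
    show "(u has_real_derivative - 2 * D s) (at s within {0..})"
      using square_norm_derivative[OF s, of g] by (simp add: u_def[abs_def] D_def)
    show "(D has_real_derivative - 2 * mean \<pi> (\<lambda>x. (generator K (semigroup_op M X s g) x)\<^sup>2))
        (at s within {0..})"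
      using energy_derivative[OF s, of g] by (simp add: D_def[abs_def])
    show "(D s)\<^sup>2 \<le> u s * mean \<pi> (\<lambda>x. (generator K (semigroup_op M X s g) x)\<^sup>2)"
      using mean_Cauchy_Schwarz[of \<pi> "semigroup_op M X s g" "generator K (semigroup_op M X s g)"]
      by (simp add: mean_generator D_def u_def)
  next
    show "0 < u t"
      unfolding u_def by (rule mean_square_pos[OF pi_pos False])
  qed (use D_nonneg t in auto)
  also have "\<dots> \<le> (c * r * t) powr (- 1 / r) / (exp 1 * t)"
    using decay t by (auto intro: divide_right_mono)
  finally have D_le: "D t \<le> (c * r * t) powr (- 1 / r) / (exp 1 * t)" .
  have "N * ?m powr (2 / p') \<le> D t * B powr ((2 - 2 * p') / p')"
    unfolding D_def using nash_inequality[OF N p' jump_rate_nonneg mean0 sup] t by simp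
  also have "\<dots> \<le> (c * r * t) powr (- 1 / r) / (exp 1 * t) * B powr ((2 - 2 * p') / p')"
    by (intro mult_right_mono D_le) simp
  finally have le: "ln (N * ?m powr (2 / p'))
      \<le> ln ((c * r * t) powr (- 1 / r) / (exp 1 * t) * B powr ((2 - 2 * p') / p'))"
    using N m B c r t by (subst ln_le_cancel_iff) auto
  \<comment> \<open>After taking logarithms, solving for \<eta>|g_t| is linear algebra in ln B, ln
    L, ln N, ln r and ln t.\<close>
  define E where "E = (2 - 2 * p') / p' * ln B
      - (ln L - (2 - 2 * p) / p * ln B + ln r + ln t) / r - (1 + ln t)"
  from le have "ln N + 2 / p' * ln ?m \<le> (2 - 2 * p') / p' * ln B - (ln c + ln r + ln t) / r - (1 + ln t)"
    using N m c r t B by (simp add: ln_mult ln_div ln_powr)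
  moreover have "ln c = ln L - (2 - 2 * p) / p * ln B"
    using L B by (simp add: c_def ln_mult ln_powr)
  ultimately have "ln N + 2 / p' * ln ?m \<le> E"
    by (simp add: E_def)
  then have "p' / 2 * (ln N + 2 / p' * ln ?m) \<le> p' / 2 * E"
    using p' by (intro mult_left_mono) auto
  then have "ln ?m \<le> p' / 2 * E - p' / 2 * ln N"
    using p' by (simp add: algebra_simps)
  \<comment> \<open>The power of B collects 1 - p' from the inequality for \<eta> and p' * (1 - p) /
    (2 - p) from the one for \<pi>. The power of t collects - p' / 2 from the energy bound and - p'
    / (2 * r) from the decay of u.\<close>
  also have "p' / 2 * E - p' / 2 * ln N
      = (1 - p' / (2 - p)) * ln B + (- p' / 2 + p * p' / (4 - 2 * p) * - ln r)
       - p' / 2 * ln N - p * p' / (4 - 2 * p) * ln L - p' / (2 - p) * ln t"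
  proof -
    define q where "q = 2 - p"
    have q: "0 < q" "p = 2 - q" "4 - 2 * p = 2 * q" "2 - p = q"
      using p by (auto simp: q_def)
    show ?thesis
      unfolding E_def r_def q(3,4) using q(1) p p' by (simp add: field_simps) (simp add: q(2) algebra_simps)
  qed
  also have "- ln r = ln (p / (2 - p))"
    using p by (simp add: r_def ln_div)
  also have "(1 - p' / (2 - p)) * ln B + (- p' / 2 + p * p' / (4 - 2 * p) * ln (p / (2 - p)))
       - p' / 2 * ln N - p * p' / (4 - 2 * p) * ln L - p' / (2 - p) * ln t = ln ?rhs"
    using B L N t p by (simp add: dist_const_def ln_mult ln_powr)
  finally show ?thesis
    using m B L N t p by (subst (asm) ln_le_cancel_iff) (auto simp: dist_const_def)
qed

lemma centred_L1_bound:
  assumes f: "sup_norm f \<le> 1" "sup_norm (\<lambda>x. f x - mean \<pi> f) \<le> B"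
    and B: "0 < B"
    and L: "nash_const K \<pi> \<pi> p = ennreal L" "0 < L"
    and N: "nash_const K \<pi> \<eta> p' = ennreal N" "0 < N"
    and p: "0 < p" "p \<le> 1" and p': "0 < p'" "p' \<le> 1"
    and t: "0 < t"
  shows "mean \<eta> (\<lambda>x. \<bar>semigroup_op M X t f x - mean \<pi> f\<bar>) \<le>
    B powr (1 - p' / (2 - p)) * dist_const p p' *
    N powr (- (p' / 2)) * L powr (- (p * p' / (4 - 2 * p))) * t powr (- p' / (2 - p))"
proof -
  define g where "g x = f x - mean \<pi> f" for x
  have Pg: "semigroup_op M X s g x = semigroup_op M X s f x - mean \<pi> f" if "0 \<le> s" for s x
    unfolding g_def by (rule semigroup_op_centre[OF that])
  have "mean \<eta> (\<lambda>x. \<bar>semigroup_op M X t g x\<bar>) \<le>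
    B powr (1 - p' / (2 - p)) * dist_const p p' *
    N powr (- (p' / 2)) * L powr (- (p * p' / (4 - 2 * p))) * t powr (- p' / (2 - p))"
  proof (rule L1_bound[OF _ _ _ B L N p p' t])
    show "mean \<pi> g = 0"
      by (simp add: g_def[abs_def] mean_diff mean_const)
    show "sup_norm g \<le> B"
      using f(2) by (simp add: g_def[abs_def])
    fix s :: real assume s: "0 \<le> s"
    have "\<bar>semigroup_op M X s f x\<bar> \<le> 1" for x
      using abs_le_sup_norm[of "semigroup_op M X s f" x] sup_norm_semigroup_op[OF s, of f] f(1) by simp
    moreover have "mean \<pi> (semigroup_op M X s f) = mean \<pi> f"
      using invariant s by (simp add: invariant_law_def)
    ultimately show "mean \<pi> (\<lambda>x. (semigroup_op M X s g x)\<^sup>2) \<le> mean \<pi> (\<lambda>x. \<bar>semigroup_op M X s g x\<bar>)"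
      using variance_le_mean_abs_deviation[of "semigroup_op M X s f" \<pi>] by (simp add: Pg[OF s])
  qed
  then show ?thesis
    using t by (simp add: Pg)
qed

section \<open>Degenerate values of the Nash constants and the bounds in [0, \<infinity>]\<close>

lemma singleton_semigroup_op:
  assumes "\<And>x y :: 'x. x = y" "0 \<le> s"
  shows "semigroup_op M X s f x = mean \<pi> f"
proof -
  obtain c where c: "f = (\<lambda>_. c)"
    using assms(1) by (metis ext)
  show ?thesis
    unfolding c using semigroup_op_diff_self[OF assms(2), of "\<lambda>_. c" x c] by (simp add: mean_const)
qed

text \<open>An admissible test function is the indicator of a point z charged by \<eta>, centred
  under \<pi>. It does not vanish at z, since a second state of positive mass forces \<pi>(z) <
  1.\<close>

lemma nash_const_less_top:
  assumes "(x::'x) \<noteq> y"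
  shows "nash_const K \<pi> \<eta> p < \<infinity>"
proof -
  obtain z where z: "0 < pmf \<eta> z"
    using set_pmf_not_empty[of \<eta>] pmf_positive[of _ \<eta>] by blast
  define f where "f v = indicator {z} v - pmf \<pi> z" for v
  obtain v where v: "v \<noteq> z"
    using assms by metis
  have "pmf \<pi> z + pmf \<pi> v = (\<Sum>w\<in>{z, v}. pmf \<pi> w)"
    using v by simp
  also have "\<dots> \<le> (\<Sum>w\<in>UNIV. pmf \<pi> w)"
    by (rule sum_mono2) auto
  finally have "pmf \<pi> z < 1"
    using pi_pos[of v] by (simp add: sum_pmf_UNIV)
  then have "0 < pmf \<eta> z * \<bar>f z\<bar>"
    using z by (simp add: f_def)
  also have "\<dots> \<le> mean \<eta> (\<lambda>x. \<bar>f x\<bar>)"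
    unfolding mean_def by (rule member_le_sum) auto
  finally have pos: "0 < mean \<eta> (\<lambda>x. \<bar>f x\<bar>)" .
  have "mean \<pi> f = mean \<pi> (indicator {z}) - pmf \<pi> z"
    unfolding f_def by (simp add: mean_diff mean_const)
  also have "mean \<pi> (indicator {z}) = pmf \<pi> z"
    by (simp add: mean_def indicator_def if_distrib[of "\<lambda>a. _ * a"] cong: if_cong)
  finally have "f \<in> {f. mean \<pi> f = 0 \<and> mean \<eta> (\<lambda>x. \<bar>f x\<bar>) > 0}"
    using pos by simp
  from INF_lower[OF this] show ?thesis
    unfolding nash_const_def by (rule le_less_trans) simp
qed

text \<open>The family F of test functions is left open so that the centred and the uncentred
  quantities are treated by one argument, with B recording the cost of centring.\<close>

lemma distance_and_mixing_bounds:
  assumes F: "\<And>f. f \<in> F \<Longrightarrow> sup_norm f \<le> 1 \<and> sup_norm (\<lambda>x. f x - mean \<pi> f) \<le> B"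
    and B: "0 < B" and p: "0 < p" "p \<le> 1" and p': "0 < p'" "p' \<le> 1"
    and d: "\<And>t. d t = (SUP s \<in> {t..}. SUP f \<in> F.
       ennreal (mean \<eta> (\<lambda>x. \<bar>semigroup_op M X s f x - mean \<pi> f\<bar>)))"
  shows "0 < t \<Longrightarrow> d t \<le>
      ennreal (B powr (1 - p' / (2 - p)) * dist_const p p') * neg_powr (nash_const K \<pi> \<eta> p') (p' / 2) *
      neg_powr (nash_const K \<pi> \<pi> p) (p * p' / (4 - 2 * p)) *
      ennreal (t powr (- p' / (2 - p)))" (is "0 < t \<Longrightarrow> _ \<le> ?dist")
    and "0 < \<epsilon> \<Longrightarrow> (INF t \<in> {t. 0 < t \<and> d t \<le> ennreal \<epsilon>}. ennreal t) \<le>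
      ennreal (B powr ((2 - p) / p' - 1) * time_const p) * neg_powr (nash_const K \<pi> \<eta> p') ((2 - p) / 2) *
      neg_powr (nash_const K \<pi> \<pi> p) (p / 2) *
      ennreal (\<epsilon> powr (- (2 - p) / p'))" (is "0 < \<epsilon> \<Longrightarrow> _ \<le> ?time")
proof -
  have dist_const: "0 < dist_const p p'" and time_const: "0 < time_const p"
    using p by (auto simp: dist_const_def time_const_def)
  consider (singleton) "\<And>x y :: 'x. x = y"
    | (degenerate) x y :: 'x where "x \<noteq> y" "nash_const K \<pi> \<eta> p' = 0 \<or> nash_const K \<pi> \<pi> p = 0"
    | (regular) N L where "nash_const K \<pi> \<eta> p' = ennreal N" "0 < N" "nash_const K \<pi> \<pi> p = ennreal L" "0 < L"
  proof (cases "nash_const K \<pi> \<eta> p' = 0 \<or> nash_const K \<pi> \<pi> p = 0 \<or> (\<forall>x y :: 'x. x = y)")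
    case False
    then obtain x y :: 'x where xy: "x \<noteq> y" by blast
    obtain N where "0 \<le> N" "nash_const K \<pi> \<eta> p' = ennreal N"
      using nash_const_less_top[OF xy, of \<eta> p'] by (cases "nash_const K \<pi> \<eta> p'") auto
    moreover obtain L where "0 \<le> L" "nash_const K \<pi> \<pi> p = ennreal L"
      using nash_const_less_top[OF xy, of \<pi> p] by (cases "nash_const K \<pi> \<pi> p") auto
    ultimately show ?thesis
      using False that(3)[of N L] by (auto simp: less_le)
  qed (use that(1,2) in blast)
  then have "(0 < t \<longrightarrow> d t \<le> ?dist) \<and>
    (0 < \<epsilon> \<longrightarrow> (INF t \<in> {t. 0 < t \<and> d t \<le> ennreal \<epsilon>}. ennreal t) \<le> ?time)"
  proof cases
    case singleton
    \<comment> \<open>On a one-point space the infima are over the empty set and the bounds are 0,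
      so the distance has to vanish. The mixing time is then the infimum of all t > 0, which is 0
      but not attained.\<close>
    have d0: "d t \<le> 0" if "0 < t" for t
      unfolding d using that singleton_semigroup_op[OF singleton]
      by (intro SUP_least) (simp add: mean_const)
    have "(INF t \<in> {t. 0 < t \<and> d t \<le> ennreal \<epsilon>}. ennreal t) \<le> 0"
    proof (rule ennreal_le_epsilon)
      fix e :: real assume "0 < e"
      then show "(INF t \<in> {t. 0 < t \<and> d t \<le> ennreal \<epsilon>}. ennreal t) \<le> 0 + ennreal e"
        using order_trans[OF d0] by (simp add: INF_lower)
    qed
    then show ?thesis
      using d0[of t] order_trans[OF _ zero_le] by blast
  next
    case degenerate
    \<comment> \<open>A vanishing Nash constant makes its factor \<infinity>. As 0 * \<infinity> = 0
      in \<open>ennreal\<close>, the bound is \<infinity> only if every other factor is nonzero;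
      finiteness of the Nash constants ensures this.\<close>
    have "0 < neg_powr (nash_const K \<pi> \<eta> p') a" "0 < neg_powr (nash_const K \<pi> \<pi> p) a" for a
      using nash_const_less_top[OF degenerate(1)]
      by (auto simp: neg_powr_def less_top[symmetric] enn2real_eq_0_iff)
    then show ?thesis
      using degenerate(2) dist_const time_const B
      by (auto simp: neg_powr_def ennreal_mult_top ennreal_top_mult ennreal_mult_eq_top_iff)
  next
    case regular
    define C where "C = B powr (1 - p' / (2 - p)) * dist_const p p' *
      N powr (- (p' / 2)) * L powr (- (p * p' / (4 - 2 * p)))"
    have C: "0 < C"
      using B dist_const regular by (simp add: C_def)
    \<comment> \<open>The supremum over later times s costs nothing because the bound decreases in
      s.\<close>
    have dt: "d t \<le> ennreal (C * t powr (- p' / (2 - p)))" if "0 < t" for t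
      unfolding d
    proof (intro SUP_least ennreal_leI)
      fix s f assume s: "s \<in> {t..}" and f: "f \<in> F"
      have "mean \<eta> (\<lambda>x. \<bar>semigroup_op M X s f x - mean \<pi> f\<bar>) \<le> C * s powr (- p' / (2 - p))"
        unfolding C_def using centred_L1_bound[OF _ _ B regular(3,4,1,2) p p'] F[OF f] s that by simp
      also have "\<dots> \<le> C * t powr (- p' / (2 - p))"
        using C s that p p' by (intro mult_left_mono powr_mono2') (auto simp: divide_simps)
      finally show "mean \<eta> (\<lambda>x. \<bar>semigroup_op M X s f x - mean \<pi> f\<bar>) \<le> C * t powr (- p' / (2 - p))" .
    qed
    have "(INF t \<in> {t. 0 < t \<and> d t \<le> ennreal \<epsilon>}. ennreal t) \<le> ?time" if \<epsilon>: "0 < \<epsilon>"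
    proof -
      \<comment> \<open>T solves C * T powr (- p' / (2 - p)) = \<epsilon>, so it is an admissible
        time in the infimum.\<close>
      define T where "T = (C / \<epsilon>) powr ((2 - p) / p')"
      have T: "0 < T"
        using C \<epsilon> by (simp add: T_def)
      have "T powr (- p' / (2 - p)) = (C / \<epsilon>) powr (- 1)"
        using p p' by (simp add: T_def powr_powr)
      then have "C * T powr (- p' / (2 - p)) = \<epsilon>"
        using C \<epsilon> by (simp add: powr_minus)
      then have "(INF t \<in> {t. 0 < t \<and> d t \<le> ennreal \<epsilon>}. ennreal t) \<le> ennreal T"
        using dt[OF T] T by (intro INF_lower) auto
      \<comment> \<open>Raising C to the power (2 - p) / p' cancels p' in the exponents of N and L
        and in the constant, turning \<open>dist_const\<close> into \<open>time_const\<close>; p'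
        survives only in the exponents of B and \<epsilon>.\<close>
      also have "T = B powr ((2 - p) / p' - 1) * time_const p * N powr (- ((2 - p) / 2)) *
          L powr (- (p / 2)) * \<epsilon> powr (- (2 - p) / p')" (is "_ = ?T")
      proof (rule ln_inj_iff[THEN iffD1])
        have ln_C: "ln C = (1 - p' / (2 - p)) * ln B + (- p' / 2 + p * p' / (4 - 2 * p) * ln (p / (2 - p)))
            - p' / 2 * ln N - p * p' / (4 - 2 * p) * ln L"
          using B regular p by (simp add: C_def dist_const_def ln_mult ln_powr)
        have ln_T: "ln ?T = ((2 - p) / p' - 1) * ln B + (- (2 - p) / 2 + p / 2 * ln (p / (2 - p)))
            - (2 - p) / 2 * ln N - p / 2 * ln L + - (2 - p) / p' * ln \<epsilon>"
          using B regular p \<epsilon> by (simp add: time_const_def ln_mult ln_powr)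
        define q where "q = 2 - p"
        have q: "0 < q" "4 - 2 * p = 2 * q" "2 - p = q"
          using p by (auto simp: q_def)
        have "ln T = (2 - p) / p' * (ln C - ln \<epsilon>)"
          using C \<epsilon> by (simp add: T_def ln_powr ln_div)
        also have "\<dots> = ln ?T"
          unfolding ln_C ln_T unfolding q(2,3) using q(1) p' by (simp add: field_simps)
        finally show "ln T = ln ?T" .
      qed (use T B time_const regular \<epsilon> in auto)
      finally show ?thesis
        using regular B time_const by (simp add: neg_powr_def ennreal_mult)
    qed
    moreover have "d t \<le> ?dist" if "0 < t"
      using dt[OF that] regular B dist_const by (simp add: neg_powr_def ennreal_mult C_def)
    ultimately show ?thesis by blast
  qed
  then show "0 < t \<Longrightarrow> d t \<le> ?dist"
    "0 < \<epsilon> \<Longrightarrow> (INF t \<in> {t. 0 < t \<and> d t \<le> ennreal \<epsilon>}. ennreal t) \<le> ?time"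
    by blast+
qed

end

theorem theorem2p1:
  fixes M :: "'x::finite \<Rightarrow> 'w measure" and X :: "real \<Rightarrow> 'w \<Rightarrow> 'x"
    and K :: "'x \<Rightarrow> 'x \<Rightarrow> real" and \<pi> \<eta> :: "'x pmf" and p p' :: real
  assumes process: "reversible_ergodic_markov_process M X K \<pi>"
    and p: "0 < p" "p \<le> 1"
    and p': "0 < p'" "p' \<le> 1"
  shows "(\<forall>t>0. dist_eq M X \<pi> \<eta> t \<le>
           ennreal (dist_const_uncentred p p') * neg_powr (nash_const K \<pi> \<eta> p') (p' / 2) *
           neg_powr (nash_const K \<pi> \<pi> p) (p * p' / (4 - 2 * p)) *
           ennreal (t powr (- p' / (2 - p)))) \<and>
       (\<forall>\<epsilon>>0. mixing_time M X \<pi> \<eta> \<epsilon> \<le>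
           ennreal (time_const_uncentred p p') * neg_powr (nash_const K \<pi> \<eta> p') ((2 - p) / 2) *
           neg_powr (nash_const K \<pi> \<pi> p) (p / 2) *
           ennreal (\<epsilon> powr (- (2 - p) / p'))) \<and>
       (\<forall>t>0. dist_eq_centred M X \<pi> \<eta> t \<le>
           ennreal (dist_const p p') * neg_powr (nash_const K \<pi> \<eta> p') (p' / 2) *
           neg_powr (nash_const K \<pi> \<pi> p) (p * p' / (4 - 2 * p)) *
           ennreal (t powr (- p' / (2 - p)))) \<and>
       (\<forall>\<epsilon>>0. mixing_time_centred M X \<pi> \<eta> \<epsilon> \<le>
           ennreal (time_const p) * neg_powr (nash_const K \<pi> \<eta> p') ((2 - p) / 2) *
           neg_powr (nash_const K \<pi> \<pi> p) (p / 2) *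
           ennreal (\<epsilon> powr (- (2 - p) / p')))"
proof -
  interpret reversible_ergodic_markov_process M X K \<pi> by (rule process)
  have centred: "sup_norm (\<lambda>x. f x - mean \<pi> f) \<le> 2" if "sup_norm f \<le> 1" for f
  proof -
    have f: "\<bar>f x\<bar> \<le> 1" for x
      using that by (simp add: sup_norm_le_iff)
    have "mean \<pi> f \<le> 1" "- 1 \<le> mean \<pi> f"
      using mean_mono[of f "\<lambda>_. 1" \<pi>] mean_mono[of "\<lambda>_. - 1" f \<pi>] f
      by (auto simp: mean_const abs_le_iff minus_le_iff)
    then have "\<bar>f x - mean \<pi> f\<bar> \<le> 2" for x
      using f[of x] by linarith
    then show ?thesis
      by (simp add: sup_norm_le_iff)
  qed
  note uncentred_bounds = distance_and_mixing_bounds[where F = "{f. sup_norm f \<le> 1}" and B = 2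
      and d = "dist_eq M X \<pi> \<eta>" and \<eta> = \<eta>, OF _ _ p p' dist_eq_def]
  note centred_bounds = distance_and_mixing_bounds[where F = "{f. sup_norm f \<le> 1 \<and> mean \<pi> f = 0}"
      and B = 1 and d = "dist_eq_centred M X \<pi> \<eta>" and \<eta> = \<eta>, OF _ _ p p' dist_eq_centred_def]
  show ?thesis
    unfolding mixing_time_def mixing_time_centred_def dist_const_uncentred_def time_const_uncentred_def
    using uncentred_bounds centred_bounds centred by auto
qed

end
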